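(* Let $\beta,\gamma,\lambda>0$ and $p\in(0,1)$, let $X\sim EEG(\beta,\gamma)$ and $W\sim EG(\lambda,p)$, let $h:(0,\infty)\to\mathbb R$ be a bounded (measurable) test function and $\tilde h(w)=h(w)-\mathbb E h(W)$. Then $$|\mathbb E h(X)-\mathbb E h(W)|\le\begin{cases}\dfrac{\|\tilde h\|}{\lambda}\left[|\lambda-\beta|\left(\dfrac{2-p}{p}+\dfrac{2(1-\gamma)}{e\gamma^2}\right)+\dfrac{2\beta}{\min(\gamma,p)^2}|p-\gamma|\right],&0<\gamma<1;\\[2ex]\dfrac{\|\tilde h\|}{\lambda p}\left[|\lambda-\beta|\left(1+(\gamma-1)(1-p)\right)+(\lambda+\beta)(\gamma-p)\right],&\gamma\ge1.\end{cases}$$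
   Context: $EG(\lambda,p)$ (exponential-geometric distribution) has pdf $\frac{\lambda pe^{-\lambda w}}{(1-(1-p)e^{-\lambda w})^2}$, $w>0$. $EEG(\beta,\gamma)$ (extended exponential-geometric distribution, $\beta,\gamma>0$) has pdf $\frac{\beta\gamma e^{-\beta x}}{(1-(1-\gamma)e^{-\beta x})^2}$, $x>0$. $\|\cdot\|$ is the supremum norm; $e$ is Euler's number. *)

theory Defs
  imports "HOL-Probability.Probability"
begin

definition EG_density :: "real \<Rightarrow> real \<Rightarrow> real \<Rightarrow> real" where
  "EG_density lam p w =
     (if w > 0 then lam * p * exp (- lam * w) / (1 - (1 - p) * exp (- lam * w))\<^sup>2 else 0)"

definition EEG_density :: "real \<Rightarrow> real \<Rightarrow> real \<Rightarrow> real" where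
  "EEG_density \<beta> \<gamma> x =
     (if x > 0 then \<beta> * \<gamma> * exp (- \<beta> * x) / (1 - (1 - \<gamma>) * exp (- \<beta> * x))\<^sup>2 else 0)"

(* A function on (0,\<infinity>) is represented by a total function whose values outside (0,\<infinity>) are
   irrelevant, so the supremum norm is taken over (0,\<infinity>) only. As SUP on the reals is
   unspecified for unbounded sets, this is meaningful only for f bounded on (0,\<infinity>). *)
definition sup_norm_pos :: "(real \<Rightarrow> real) \<Rightarrow> real" where
  "sup_norm_pos f = (SUP w\<in>{0<..}. \<bar>f w\<bar>)"

end

theory Submission
  imports Defs
begin

text \<open>
  Since \<open>h - E h(W)\<close> is centred under the law of \<open>W\<close>, the error is at most the supremum norm
  times the \<open>L\<^sup>1\<close> norm of \<open>f\<^sub>X - k f\<^sub>W\<close> for any constant \<open>k\<close>. One chooses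
  \<open>k = (\<beta>/\<lambda>) c\<close> with \<open>c = min \<gamma> p / max \<gamma> p\<close> and changes one parameter at a time.
  Both steps compare pointwise ordered functions, so their \<open>L\<^sup>1\<close> distances can be read off
  the total masses: for \<open>\<gamma> \<le> 1\<close> the density divided by \<open>\<beta>\<close> is an increasing function of
  \<open>exp (- \<beta> x)\<close>, giving \<open>|1 - \<beta>/\<lambda>|\<close>, while replacing \<open>\<gamma>\<close> by \<open>p\<close> costs \<open>1 - c\<close>.
  The rate has to be changed at a shape parameter at most 1: at \<open>\<gamma>\<close> if \<open>\<gamma> < 1\<close>, at \<open>p\<close> otherwise.
\<close>

section \<open>Densities of both families and their total mass\<close>

lemma EG_density_eq_EEG_density: "EG_density = EEG_density"
  by (simp add: fun_eq_iff EG_density_def EEG_density_def)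

text \<open>Since \<open>\<gamma> * u\<close> is nonnegative, the expression is at least
  \<open>1 - u\<close>, which can vanish only at \<open>u = 1\<close>; there the value is
  \<open>\<gamma>\<close> itself. It is applied to \<open>u = exp (- \<beta> * x)\<close>.\<close>

lemma EEG_denom_pos:
  fixes \<gamma> u :: real
  assumes "0 < \<gamma>" "0 \<le> u" "u \<le> 1"
  shows "0 < 1 - (1 - \<gamma>) * u"
proof (cases "u = 1")
  case False
  have "(1 - \<gamma>) * u \<le> u" using assms by (simp add: algebra_simps)
  with False assms show ?thesis by simp
qed (use assms in simp)

lemma EEG_density_nonneg: "0 < \<beta> \<Longrightarrow> 0 < \<gamma> \<Longrightarrow> 0 \<le> EEG_density \<beta> \<gamma> x"
  by (simp add: EEG_density_def)

lemma EEG_density_eq_0: "x \<le> 0 \<Longrightarrow> EEG_density \<beta> \<gamma> x = 0"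
  by (simp add: EEG_density_def)

lemma EEG_density_measurable [measurable]: "EEG_density \<beta> \<gamma> \<in> borel_measurable borel"
  unfolding EEG_density_def by measurable

lemma has_bochner_integral_EEG_density:
  assumes \<beta>: "0 < \<beta>" and \<gamma>: "0 < \<gamma>"
  shows "has_bochner_integral lborel (EEG_density \<beta> \<gamma>) 1"
proof (rule has_bochner_integral_nn_integral)
  define f where "f x = \<beta> * \<gamma> * exp (- \<beta> * x) / (1 - (1 - \<gamma>) * exp (- \<beta> * x))\<^sup>2" for x
  \<comment> \<open>An antiderivative of \<open>f\<close>, with the constant chosen so that it
    vanishes at infinity; then \<open>F 0 = -1\<close>.\<close>
  define F where "F x = - \<gamma> * exp (- \<beta> * x) / (1 - (1 - \<gamma>) * exp (- \<beta> * x))" for x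
  have "(\<integral>\<^sup>+x. ennreal (f x) * indicator {0..} x \<partial>lborel) = ennreal (0 - F 0)"
  proof (rule nn_integral_FTC_atLeast)
    show "f \<in> borel_measurable borel" unfolding f_def by measurable
    show "(F has_real_derivative f x) (at x)" if "0 \<le> x" for x
    proof -
      have "1 - (1 - \<gamma>) * exp (- \<beta> * x) > 0"
        by (rule EEG_denom_pos) (use \<beta> \<gamma> that in auto)
      then show ?thesis unfolding F_def f_def
        by (auto intro!: derivative_eq_intros simp: field_simps power2_eq_square)
    qed
    show "0 \<le> f x" if "0 \<le> x" for x using \<beta> \<gamma> by (simp add: f_def)
    have "((\<lambda>x. exp (- \<beta> * x)) \<longlongrightarrow> 0) at_top"
      using \<beta> by real_asymp
    then have "(F \<longlongrightarrow> - \<gamma> * 0 / (1 - (1 - \<gamma>) * 0)) at_top"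
      unfolding F_def by (intro tendsto_intros) auto
    then show "(F \<longlongrightarrow> 0) at_top" by simp
  qed
  also have "0 - F 0 = 1" using \<gamma> by (simp add: F_def)
  \<comment> \<open>The integrands differ only at \<open>0\<close>, where \<open>f\<close> is
    positive but the density is set to \<open>0\<close>.\<close>
  also have "(\<integral>\<^sup>+x. ennreal (f x) * indicator {0..} x \<partial>lborel)
    = (\<integral>\<^sup>+x. ennreal (EEG_density \<beta> \<gamma> x) \<partial>lborel)"
    by (intro nn_integral_cong_AE AE_I[where N = "{0}"])
      (auto simp: f_def EEG_density_def indicator_def split: if_splits)
  finally show "(\<integral>\<^sup>+x. ennreal (EEG_density \<beta> \<gamma> x) \<partial>lborel) = ennreal 1" .
qed (use assms in \<open>auto simp: EEG_density_nonneg\<close>)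

lemma
  assumes "0 < \<beta>" "0 < \<gamma>"
  shows integrable_EEG_density: "integrable lborel (EEG_density \<beta> \<gamma>)"
    and integral_EEG_density: "integral\<^sup>L lborel (EEG_density \<beta> \<gamma>) = 1"
  using has_bochner_integral_EEG_density[OF assms] by (auto simp: has_bochner_integral_iff)

section \<open>Distances in mean under a change of rate or of shape\<close>

lemma integral_abs_diff_comparable:
  fixes f g :: "'a \<Rightarrow> real"
  assumes "integrable M f" "integrable M g"
    and "(\<forall>x. f x \<le> g x) \<or> (\<forall>x. g x \<le> f x)"
  shows "(\<integral>x. \<bar>f x - g x\<bar> \<partial>M) = \<bar>integral\<^sup>L M f - integral\<^sup>L M g\<bar>"
  using assms(3)
proof
  assume le: "\<forall>x. f x \<le> g x"
  have "integral\<^sup>L M f \<le> integral\<^sup>L M g" using assms le by (intro integral_mono) auto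
  moreover have "(\<integral>x. \<bar>f x - g x\<bar> \<partial>M) = (\<integral>x. g x - f x \<partial>M)"
    using le by (intro Bochner_Integration.integral_cong) auto
  ultimately show ?thesis using assms by simp
next
  assume le: "\<forall>x. g x \<le> f x"
  have "integral\<^sup>L M g \<le> integral\<^sup>L M f" using assms le by (intro integral_mono) auto
  moreover have "(\<integral>x. \<bar>f x - g x\<bar> \<partial>M) = (\<integral>x. f x - g x \<partial>M)"
    using le by (intro Bochner_Integration.integral_cong) auto
  ultimately show ?thesis using assms by simp
qed

text \<open>Dividing by the rate leaves a function of the exponential alone. For
  \<open>\<gamma> \<le> 1\<close>, a larger exponential raises the numerator and lowers the positive
  denominator, and the smaller rate has the larger exponential.\<close>

lemma EEG_density_scale_mono:
  assumes "0 < \<beta>" "\<beta> \<le> lam" "0 < \<gamma>" "\<gamma> \<le> 1"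
  shows "EEG_density lam \<gamma> x / lam \<le> EEG_density \<beta> \<gamma> x / \<beta>"
proof (cases "x > 0")
  case True
  define u v where "u = exp (- lam * x)" and "v = exp (- \<beta> * x)"
  have uv: "0 < u" "u \<le> v" "v \<le> 1" using True assms by (auto simp: u_def v_def)
  have "\<gamma> * u / (1 - (1 - \<gamma>) * u)\<^sup>2 \<le> \<gamma> * v / (1 - (1 - \<gamma>) * v)\<^sup>2"
  proof (rule frac_le)
    show "0 < (1 - (1 - \<gamma>) * v)\<^sup>2" using EEG_denom_pos[of \<gamma> v] uv assms by simp
    show "(1 - (1 - \<gamma>) * v)\<^sup>2 \<le> (1 - (1 - \<gamma>) * u)\<^sup>2"
      using EEG_denom_pos[of \<gamma> v] uv assms
      by (intro power_mono diff_left_mono mult_left_mono) auto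
  qed (use uv assms in auto)
  with True assms show ?thesis by (simp add: EEG_density_def u_def v_def mult.assoc)
qed (simp add: EEG_density_def)

lemma integral_abs_EEG_density_scale:
  assumes "0 < \<beta>" "0 < lam" "0 < \<gamma>" "\<gamma> \<le> 1"
  shows "(\<integral>x. \<bar>EEG_density \<beta> \<gamma> x - \<beta> / lam * EEG_density lam \<gamma> x\<bar> \<partial>lborel) = \<bar>1 - \<beta> / lam\<bar>"
proof -
  have "EEG_density \<beta> \<gamma> x \<le> \<beta> / lam * EEG_density lam \<gamma> x" if "lam \<le> \<beta>" for x
    using EEG_density_scale_mono[of lam \<beta> \<gamma> x] that assms by (simp add: field_simps)
  moreover have "\<beta> / lam * EEG_density lam \<gamma> x \<le> EEG_density \<beta> \<gamma> x" if "\<beta> \<le> lam" for x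
    using EEG_density_scale_mono[of \<beta> lam \<gamma> x] that assms by (simp add: field_simps)
  ultimately have "(\<forall>x. EEG_density \<beta> \<gamma> x \<le> \<beta> / lam * EEG_density lam \<gamma> x)
      \<or> (\<forall>x. \<beta> / lam * EEG_density lam \<gamma> x \<le> EEG_density \<beta> \<gamma> x)"
    by (meson linear)
  from integral_abs_diff_comparable[OF _ _ this, of lborel] assms show ?thesis
    by (simp add: integrable_EEG_density integral_EEG_density)
qed

text \<open>The quotient of the two densities is \<open>\<gamma> / p * (A / B)\<^sup>2\<close> and
  is monotone in \<open>u\<close>. It runs from \<open>\<gamma> / p\<close> at \<open>u = 0\<close>
  to \<open>p / \<gamma>\<close> at \<open>u = 1\<close>, and the smaller of these limits is
  \<open>min \<gamma> p / max \<gamma> p\<close>.\<close>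

lemma EEG_density_shape_ge:
  assumes "0 < \<beta>" "0 < \<gamma>" "0 < p"
  shows "min \<gamma> p / max \<gamma> p * EEG_density \<beta> p x \<le> EEG_density \<beta> \<gamma> x"
proof (cases "x > 0")
  case True
  define u where "u = exp (- \<beta> * x)"
  have u: "0 < u" "u \<le> 1" using True assms by (auto simp: u_def)
  define A B where "A = 1 - (1 - p) * u" and "B = 1 - (1 - \<gamma>) * u"
  have pos: "0 < A" "0 < B" using EEG_denom_pos u assms by (auto simp: A_def B_def)
  \<comment> \<open>The claim with the denominators cleared and the common factor
    \<open>\<beta> * u\<close> removed.\<close>
  have "min \<gamma> p / max \<gamma> p * p * B\<^sup>2 \<le> \<gamma> * A\<^sup>2"
  proof (cases "\<gamma> \<le> p")
    case True
    then have "B \<le> A" using u by (simp add: A_def B_def)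
    then have "B\<^sup>2 \<le> A\<^sup>2" using pos by (intro power_mono) auto
    then show ?thesis using True assms by simp
  next
    case False
    \<comment> \<open>Here the factor is \<open>p / \<gamma>\<close>, so multiplying by
      \<open>\<gamma>\<close> turns the goal into a comparison of the squares of
      \<open>p * B\<close> and \<open>\<gamma> * A\<close>.\<close>
    have "\<gamma> * A - p * B = (\<gamma> - p) * (1 - u)" by (simp add: A_def B_def algebra_simps)
    also have "\<dots> \<ge> 0" using False u by simp
    finally have "(p * B)\<^sup>2 \<le> (\<gamma> * A)\<^sup>2" using pos assms by (intro power_mono) auto
    then have "p\<^sup>2 * B\<^sup>2 / \<gamma> \<le> \<gamma> * A\<^sup>2"
      using assms by (simp add: divide_le_eq power_mult_distrib power2_eq_square ac_simps)
    then show ?thesis using False by (simp add: power2_eq_square)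
  qed
  then have "\<beta> * u * (min \<gamma> p / max \<gamma> p * p * B\<^sup>2) \<le> \<beta> * u * (\<gamma> * A\<^sup>2)"
    using assms u by (intro mult_left_mono) auto
  then have "\<beta> * u * (min \<gamma> p / max \<gamma> p * p * B\<^sup>2) / (A\<^sup>2 * B\<^sup>2)
      \<le> \<beta> * u * (\<gamma> * A\<^sup>2) / (A\<^sup>2 * B\<^sup>2)"
    by (rule divide_right_mono) simp
  then have "min \<gamma> p / max \<gamma> p * (\<beta> * p * u / A\<^sup>2) \<le> \<beta> * \<gamma> * u / B\<^sup>2"
    using pos by (simp add: ac_simps)
  then show ?thesis using True by (simp add: EEG_density_def A_def B_def u_def)
qed (simp add: EEG_density_def)

lemma integral_abs_EEG_density_shape:
  assumes "0 < \<beta>" "0 < \<gamma>" "0 < p"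
  shows "(\<integral>x. \<bar>EEG_density \<beta> \<gamma> x - min \<gamma> p / max \<gamma> p * EEG_density \<beta> p x\<bar> \<partial>lborel)
    = \<bar>p - \<gamma>\<bar> / max \<gamma> p"
proof -
  have "(\<integral>x. \<bar>EEG_density \<beta> \<gamma> x - min \<gamma> p / max \<gamma> p * EEG_density \<beta> p x\<bar> \<partial>lborel)
    = \<bar>1 - min \<gamma> p / max \<gamma> p\<bar>"
    using integral_abs_diff_comparable[OF _ _ disjI2, of lborel "EEG_density \<beta> \<gamma>"
      "\<lambda>x. min \<gamma> p / max \<gamma> p * EEG_density \<beta> p x"] EEG_density_shape_ge assms
    by (simp add: integrable_EEG_density integral_EEG_density)
  also have "\<dots> = \<bar>p - \<gamma>\<bar> / max \<gamma> p"
    using assms by (auto simp: min_def max_def field_simps)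
  finally show ?thesis .
qed

section \<open>Chaining two changes and passing to expectations\<close>

lemma integral_abs_diff_triangle:
  fixes f g k :: "'a \<Rightarrow> real"
  assumes "integrable M f" "integrable M g" "integrable M k" "0 \<le> c"
  shows "(\<integral>x. \<bar>f x - c * d * k x\<bar> \<partial>M)
    \<le> (\<integral>x. \<bar>f x - c * g x\<bar> \<partial>M) + c * (\<integral>x. \<bar>g x - d * k x\<bar> \<partial>M)"
proof -
  have "\<bar>f x - c * d * k x\<bar> \<le> \<bar>f x - c * g x\<bar> + c * \<bar>g x - d * k x\<bar>" for x
  proof -
    have "f x - c * d * k x = (f x - c * g x) + c * (g x - d * k x)" by (simp add: algebra_simps)
    then show ?thesis using abs_triangle_ineq \<open>0 \<le> c\<close> by (metis abs_mult abs_of_nonneg)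
  qed
  then have "(\<integral>x. \<bar>f x - c * d * k x\<bar> \<partial>M)
      \<le> (\<integral>x. \<bar>f x - c * g x\<bar> + c * \<bar>g x - d * k x\<bar> \<partial>M)"
    using assms by (intro integral_mono) auto
  then show ?thesis using assms by simp
qed

text \<open>The constant \<open>c\<close> is free because \<open>h - m\<close> is centred under \<open>g\<close>.\<close>

lemma abs_integral_diff_le_integral_abs:
  fixes f g h :: "real \<Rightarrow> real"
  assumes f: "integrable lborel f" "integral\<^sup>L lborel f = 1"
    and g: "integrable lborel g" "integral\<^sup>L lborel g = 1"
    and zero: "\<And>x. x \<notin> S \<Longrightarrow> f x = 0 \<and> g x = 0"
    and h: "h \<in> borel_measurable borel"
    and m: "m = (\<integral>x. g x * h x \<partial>lborel)"
    and le: "\<And>x. x \<in> S \<Longrightarrow> \<bar>h x - m\<bar> \<le> H"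
  shows "\<bar>(\<integral>x. f x * h x \<partial>lborel) - m\<bar> \<le> H * (\<integral>x. \<bar>f x - c * g x\<bar> \<partial>lborel)"
proof -
  \<comment> \<open>Nothing bounds \<open>h\<close> off \<open>S\<close>, but \<open>q\<close>
    vanishes there, so \<open>H * q\<close> dominates the product everywhere.\<close>
  have int: "integrable lborel (\<lambda>x. q x * (h x - m))"
    if q: "integrable lborel q" "\<And>x. x \<notin> S \<Longrightarrow> q x = 0" for q :: "real \<Rightarrow> real"
  proof (rule Bochner_Integration.integrable_bound[where f = "\<lambda>x. H * q x"])
    show "AE x in lborel. norm (q x * (h x - m)) \<le> norm (H * q x)"
    proof (rule AE_I2)
      show "norm (q x * (h x - m)) \<le> norm (H * q x)" for x
      proof (cases "x \<in> S")
        case True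
        have "\<bar>h x - m\<bar> * \<bar>q x\<bar> \<le> \<bar>H\<bar> * \<bar>q x\<bar>"
          using le[OF True] by (intro mult_right_mono) auto
        then show ?thesis by (simp add: abs_mult mult.commute)
      qed (use q in simp)
    qed
  qed (use q h in auto)
  have split: "(\<integral>x. q x * (h x - m) \<partial>lborel) = (\<integral>x. q x * h x \<partial>lborel) - m"
    if q: "integrable lborel q" "integral\<^sup>L lborel q = 1" "\<And>x. x \<notin> S \<Longrightarrow> q x = 0"
    for q :: "real \<Rightarrow> real"
  proof -
    have "(\<integral>x. q x * h x \<partial>lborel) = (\<integral>x. q x * (h x - m) + q x * m \<partial>lborel)"
      by (simp add: algebra_simps)
    also have "\<dots> = (\<integral>x. q x * (h x - m) \<partial>lborel) + m"
      using int[of q] q by (subst Bochner_Integration.integral_add) auto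
    finally show ?thesis by simp
  qed
  have bd: "\<bar>(f x - c * g x) * (h x - m)\<bar> \<le> H * \<bar>f x - c * g x\<bar>" for x
  proof (cases "x \<in> S")
    case True
    then show ?thesis using le mult_right_mono[of "\<bar>h x - m\<bar>" H "\<bar>f x - c * g x\<bar>"]
      by (simp add: abs_mult mult.commute)
  qed (use zero in simp)
  \<comment> \<open>The subtracted term is zero: \<open>m\<close> is the mean of \<open>h\<close>
    under \<open>g\<close>, and \<open>g\<close> has mass 1. This is how an arbitrary
    \<open>c\<close> enters.\<close>
  have "(\<integral>x. f x * h x \<partial>lborel) - m
      = (\<integral>x. f x * (h x - m) \<partial>lborel) - c * (\<integral>x. g x * (h x - m) \<partial>lborel)"
    using split[of f] split[of g] f g zero m by simp
  also have "\<dots> = (\<integral>x. f x * (h x - m) - c * (g x * (h x - m)) \<partial>lborel)"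
    using int[of f] int[of g] f g zero by (subst Bochner_Integration.integral_diff) auto
  also have "\<dots> = (\<integral>x. (f x - c * g x) * (h x - m) \<partial>lborel)"
    by (simp add: algebra_simps)
  also have "\<bar>\<dots>\<bar> \<le> (\<integral>x. \<bar>(f x - c * g x) * (h x - m)\<bar> \<partial>lborel)"
    by (rule integral_abs_bound)
  also have "\<dots> \<le> (\<integral>x. H * \<bar>f x - c * g x\<bar> \<partial>lborel)"
    using f g zero int[of "\<lambda>x. f x - c * g x"] bd
    by (intro integral_mono) auto
  finally show ?thesis by simp
qed

section \<open>The supremum norm and the two routes from one law to the other\<close>

lemma abs_le_sup_norm_pos:
  assumes "bounded (f ` {0<..})" "w > 0"
  shows "\<bar>f w\<bar> \<le> sup_norm_pos f"
  unfolding sup_norm_pos_def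
proof (rule cSUP_upper)
  show "bdd_above ((\<lambda>w. \<bar>f w\<bar>) ` {0<..})"
    using assms(1) by (auto simp: bounded_iff bdd_above_def)
qed (use assms in simp)

text \<open>The intermediate density has rate \<open>lam\<close> and shape \<open>\<gamma>\<close>,
  so the rate changes where the shape is at most 1. The later shape error is weighted by
  \<open>\<beta> / lam\<close>.\<close>

lemma EEG_L1_le_scale_first:
  assumes "0 < \<beta>" "0 < lam" "0 < \<gamma>" "\<gamma> \<le> 1" "0 < p"
  shows "(\<integral>x. \<bar>EEG_density \<beta> \<gamma> x - \<beta> / lam * (min \<gamma> p / max \<gamma> p) * EEG_density lam p x\<bar> \<partial>lborel)
    \<le> \<bar>1 - \<beta> / lam\<bar> + \<beta> / lam * (\<bar>p - \<gamma>\<bar> / max \<gamma> p)"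
  using integral_abs_diff_triangle[of lborel "EEG_density \<beta> \<gamma>" "EEG_density lam \<gamma>"
      "EEG_density lam p" "\<beta> / lam" "min \<gamma> p / max \<gamma> p"] assms
  by (simp only: integral_abs_EEG_density_scale integral_abs_EEG_density_shape
      integrable_EEG_density) simp

text \<open>The intermediate density has rate \<open>\<beta>\<close> and shape \<open>p\<close>, so
  \<gamma> may exceed 1. The later rate error is weighted by
  \<open>min \<gamma> p / max \<gamma> p\<close>.\<close>

lemma EEG_L1_le_shape_first:
  assumes "0 < \<beta>" "0 < lam" "0 < \<gamma>" "0 < p" "p \<le> 1"
  shows "(\<integral>x. \<bar>EEG_density \<beta> \<gamma> x - min \<gamma> p / max \<gamma> p * (\<beta> / lam) * EEG_density lam p x\<bar> \<partial>lborel)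
    \<le> \<bar>p - \<gamma>\<bar> / max \<gamma> p + min \<gamma> p / max \<gamma> p * \<bar>1 - \<beta> / lam\<bar>"
  using integral_abs_diff_triangle[of lborel "EEG_density \<beta> \<gamma>" "EEG_density \<beta> p"
      "EEG_density lam p" "min \<gamma> p / max \<gamma> p" "\<beta> / lam"] assms
  by (simp only: integral_abs_EEG_density_scale integral_abs_EEG_density_shape
      integrable_EEG_density) simp

theorem theorem5p4:
  fixes M :: "'a measure" and N :: "'b measure"
    and X :: "'a \<Rightarrow> real" and W :: "'b \<Rightarrow> real"
    and h h' :: "real \<Rightarrow> real"
    and \<beta> \<gamma> lam p :: real
  assumes "\<beta> > 0" and "\<gamma> > 0" and "lam > 0" and "0 < p" and "p < 1"
    and "prob_space M" and "prob_space N"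
    and "distributed M lborel X (\<lambda>x. ennreal (EEG_density \<beta> \<gamma> x))"
    and "distributed N lborel W (\<lambda>w. ennreal (EG_density lam p w))"
    and "h \<in> borel_measurable borel"
    and "bounded (h ` {0<..})"
    and "h' = (\<lambda>w. h w - prob_space.expectation N (\<lambda>\<omega>. h (W \<omega>)))"
  shows "\<bar>prob_space.expectation M (\<lambda>\<omega>. h (X \<omega>)) - prob_space.expectation N (\<lambda>\<omega>. h (W \<omega>))\<bar>
    \<le> (if \<gamma> < 1 then
          sup_norm_pos h' / lam *
            (\<bar>lam - \<beta>\<bar> * ((2 - p) / p + 2 * (1 - \<gamma>) / (exp 1 * \<gamma>\<^sup>2))
              + 2 * \<beta> / (min \<gamma> p)\<^sup>2 * \<bar>p - \<gamma>\<bar>)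
        else
          sup_norm_pos h' / (lam * p) *
            (\<bar>lam - \<beta>\<bar> * (1 + (\<gamma> - 1) * (1 - p)) + (lam + \<beta>) * (\<gamma> - p)))"
proof -
  define H where "H = sup_norm_pos h'"
  define m where "m = prob_space.expectation N (\<lambda>\<omega>. h (W \<omega>))"
  \<comment> \<open>The claimed bound with the factor \<open>H\<close> taken out; it remains to
    bound the distance in mean by \<open>B\<close> for one suitable \<open>c\<close>.\<close>
  define B where "B = (if \<gamma> < 1 then
      (\<bar>lam - \<beta>\<bar> * ((2 - p) / p + 2 * (1 - \<gamma>) / (exp 1 * \<gamma>\<^sup>2)) + 2 * \<beta> / (min \<gamma> p)\<^sup>2 * \<bar>p - \<gamma>\<bar>) / lam
    else (\<bar>lam - \<beta>\<bar> * (1 + (\<gamma> - 1) * (1 - p)) + (lam + \<beta>) * (\<gamma> - p)) / (lam * p))"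
  note pos = \<open>\<beta> > 0\<close> \<open>\<gamma> > 0\<close> \<open>lam > 0\<close> \<open>0 < p\<close>
  have h'_eq: "h' = (\<lambda>w. h w - m)" using assms(12) by (simp add: m_def)
  have "bounded (h' ` {0<..})"
    using bounded_translation[OF assms(11), of "- m"] by (simp add: h'_eq image_image)
  then have le_H: "\<bar>h w - m\<bar> \<le> H" if "w > 0" for w
    using abs_le_sup_norm_pos[of h' w] that by (simp add: H_def h'_eq)
  have "0 \<le> H" using le_H[of 1] by simp
  have EX: "prob_space.expectation M (\<lambda>\<omega>. h (X \<omega>)) = (\<integral>x. EEG_density \<beta> \<gamma> x * h x \<partial>lborel)"
    using distributed_integral[OF assms(8), of h] assms(10) pos by (simp add: EEG_density_nonneg)
  have EW: "m = (\<integral>x. EEG_density lam p x * h x \<partial>lborel)"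
    using distributed_integral[OF assms(9), of h] assms(10) pos
    by (simp add: m_def EG_density_eq_EEG_density EEG_density_nonneg)
  have centred: "\<bar>(\<integral>x. EEG_density \<beta> \<gamma> x * h x \<partial>lborel) - m\<bar>
      \<le> H * (\<integral>x. \<bar>EEG_density \<beta> \<gamma> x - c * EEG_density lam p x\<bar> \<partial>lborel)" for c
    by (rule abs_integral_diff_le_integral_abs[where S = "{0<..}"])
      (use pos assms(10) EW le_H in
        \<open>auto simp: integrable_EEG_density integral_EEG_density EEG_density_eq_0\<close>)
  have b: "\<bar>1 - \<beta> / lam\<bar> = \<bar>lam - \<beta>\<bar> / lam"
  proof -
    have "1 - \<beta> / lam = (lam - \<beta>) / lam" using pos by (simp add: diff_divide_distrib)
    then show ?thesis using pos by (simp add: abs_divide)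
  qed
  have "\<exists>c. (\<integral>x. \<bar>EEG_density \<beta> \<gamma> x - c * EEG_density lam p x\<bar> \<partial>lborel) \<le> B"
  proof (cases "\<gamma> < 1")
    case True
    \<comment> \<open>The route through shape \<gamma> gives
      \<open>\<bar>lam - \<beta>\<bar>\<close> the coefficient 1 after multiplication by
      \<open>lam\<close>; the stated coefficient is at least that.\<close>
    have "1 \<le> (2 - p) / p" using pos \<open>p < 1\<close> by (simp add: field_simps)
    moreover have "0 \<le> 2 * (1 - \<gamma>) / (exp 1 * \<gamma>\<^sup>2)" using True by simp
    ultimately have 1: "\<bar>lam - \<beta>\<bar> * 1 \<le> \<bar>lam - \<beta>\<bar> * ((2 - p) / p + 2 * (1 - \<gamma>) / (exp 1 * \<gamma>\<^sup>2))"
      by (intro mult_left_mono) auto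
    \<comment> \<open>As the minimum is below 1, its square is at most the minimum and hence at most
      \<open>max \<gamma> p\<close>. The factor 2 is slack.\<close>
    have "(min \<gamma> p)\<^sup>2 \<le> min \<gamma> p * 1" unfolding power2_eq_square
      using pos True by (intro mult_left_mono) auto
    then have "\<bar>p - \<gamma>\<bar> / max \<gamma> p \<le> 2 * \<bar>p - \<gamma>\<bar> / (min \<gamma> p)\<^sup>2"
      using pos by (intro frac_le) auto
    then have "\<beta> * (\<bar>p - \<gamma>\<bar> / max \<gamma> p) \<le> \<beta> * (2 * \<bar>p - \<gamma>\<bar> / (min \<gamma> p)\<^sup>2)"
      using pos by (intro mult_left_mono) auto
    then have 2: "\<beta> * (\<bar>p - \<gamma>\<bar> / max \<gamma> p) \<le> 2 * \<beta> / (min \<gamma> p)\<^sup>2 * \<bar>p - \<gamma>\<bar>"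
      by (simp add: ac_simps)
    have "\<bar>1 - \<beta> / lam\<bar> + \<beta> / lam * (\<bar>p - \<gamma>\<bar> / max \<gamma> p)
        = (\<bar>lam - \<beta>\<bar> * 1 + \<beta> * (\<bar>p - \<gamma>\<bar> / max \<gamma> p)) / lam"
      by (simp add: b add_divide_distrib)
    also have "\<dots> \<le> B"
      using True pos add_mono[OF 1 2] by (auto simp: B_def intro!: divide_right_mono)
    finally show ?thesis
      using order_trans[OF EEG_L1_le_scale_first[of \<beta> lam \<gamma> p]] True pos less_imp_le by blast
  next
    case False
    then have mm: "min \<gamma> p = p" "max \<gamma> p = \<gamma>" "\<bar>p - \<gamma>\<bar> = \<gamma> - p" using \<open>p < 1\<close> by auto
    \<comment> \<open>The shape error: \<open>1 / \<gamma>\<close> is enlarged to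
      \<open>1 / p\<close>, then \<open>lam\<close> to \<open>lam + \<beta>\<close>.\<close>
    have "(\<gamma> - p) / \<gamma> \<le> (\<gamma> - p) / p"
      using False pos \<open>p < 1\<close> by (intro divide_left_mono) auto
    also have "\<dots> = lam * (\<gamma> - p) / (lam * p)" using pos by simp
    also have "\<dots> \<le> (lam + \<beta>) * (\<gamma> - p) / (lam * p)"
      using False pos \<open>p < 1\<close> by (intro divide_right_mono mult_right_mono) auto
    finally have 1: "(\<gamma> - p) / \<gamma> \<le> (lam + \<beta>) * (\<gamma> - p) / (lam * p)" .
    \<comment> \<open>The rate error: its weight \<open>p / \<gamma>\<close> is at most
      \<open>1 / p\<close>, and the stated factor \<open>1 + (\<gamma> - 1) * (1 - p)\<close> is at
      least 1.\<close>
    have "p / \<gamma> * (\<bar>lam - \<beta>\<bar> / lam) \<le> 1 / p * (\<bar>lam - \<beta>\<bar> / lam)"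
      using False pos \<open>p < 1\<close> by (intro mult_right_mono frac_le) auto
    also have "\<dots> = \<bar>lam - \<beta>\<bar> * 1 / (lam * p)" by simp
    also have "\<dots> \<le> \<bar>lam - \<beta>\<bar> * (1 + (\<gamma> - 1) * (1 - p)) / (lam * p)"
      using False pos \<open>p < 1\<close> by (intro divide_right_mono mult_left_mono) auto
    finally have "\<bar>p - \<gamma>\<bar> / max \<gamma> p + min \<gamma> p / max \<gamma> p * \<bar>1 - \<beta> / lam\<bar> \<le> B"
      using False 1 by (simp add: B_def b mm add_divide_distrib)
    then show ?thesis
      using order_trans[OF EEG_L1_le_shape_first[of \<beta> lam \<gamma> p]] pos \<open>p < 1\<close> less_imp_le by blast
  qed
  then obtain c where c: "(\<integral>x. \<bar>EEG_density \<beta> \<gamma> x - c * EEG_density lam p x\<bar> \<partial>lborel) \<le> B" ..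
  have "\<bar>(\<integral>x. EEG_density \<beta> \<gamma> x * h x \<partial>lborel) - m\<bar> \<le> H * B"
    using centred[of c] mult_left_mono[OF c \<open>0 \<le> H\<close>] by linarith
  then show ?thesis
    by (cases "\<gamma> < 1") (simp_all add: EX B_def flip: H_def m_def)
qed

end
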